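(* Let $(X,d)$ be a metric space and let $f$ be a semi-flow or a flow on $X$. If $p\in X$ is an unpredictable point, then the dynamics on $\Omega_p^+=\overline{\mathcal{T}^+(p)}$ is sensitive.
   Context: Let $\mathbb{T}$ be either the set of real numbers or the set of integers, and let $\mathbb{T}_+$ be the set of nonnegative elements of $\mathbb{T}$. A flow on the metric space $(X,d)$ is a mapping $f:\mathbb{T}\times X\to X$ such that (i) $f(0,p)=p$ for all $p\in X$; (ii) $f(t,p)$ is continuous in the pair of variables $(t,p)$; (iii) $f(t_1,f(t_2,p))=f(t_1+t_2,p)$ for all $t_1,t_2\in\mathbb{T}$ and $p\in X$. A semi-flow on $X$ is a mapping $f:\mathbb{T}_+\times X\to X$ satisfying (i)-(iii) with $\mathbb{T}$ replaced by $\mathbb{T}_+$. The positive semi-trajectory through $p\in X$ is $\mathcal{T}^+(p)=\{f(t,p): t\in\mathbb{T}_+\}$, and $\Omega_p^+=\overline{\mathcal{T}^+(p)}$ is its closure in $X$. A point $p\in X$ is unpredictable if there exist a number $\epsilon_0>0$ (the sensitivity constant) and sequences $\{t_n\}_{n\in\mathbb{N}}$, $\{\tau_n\}_{n\in\mathbb{N}}$ in $\mathbb{T}_+$, both of which diverge to (positive) infinity, such that $\lim_{n\to\infty}f(t_n,p)=p$ and $d[f(t_n+\tau_n,p),f(\tau_n,p)]\ge\epsilon_0$ for each $n\in\mathbb{N}$. The dynamics on a set $S\subseteq X$ is sensitive if there exists a positive number $\epsilon_0$ such that for each $u\in S$ and each positive number $\delta$ there exist a point $u_\delta\in S$ and a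 positive $\tau_\delta\in\mathbb{T}_+$ such that $d[u_\delta,u]<\delta$ and $d[f(\tau_\delta,u_\delta),f(\tau_\delta,u)]\ge\epsilon_0$. (The constant $\epsilon_0$ in this definition need not equal the sensitivity constant of $p$.) *)

theory Defs
  imports "HOL-Analysis.Analysis"
begin

text \<open>
  The phase space X is a type of class \<open>metric_space\<close>. The time set T is a set of reals: \<open>UNIV\<close>
  for the reals or \<open>\<int>\<close> for the integers, the latter carrying the discrete subspace topology.
  A dynamical system is a function \<open>f :: real \<Rightarrow> 'a \<Rightarrow> 'a\<close> whose values at times outside
  T (for semi-flows: outside the nonnegative part of T) are irrelevant.
\<close>

definition nonneg :: "real set \<Rightarrow> real set" where
  "nonneg T = {t \<in> T. 0 \<le> t}"

definition flow_axioms_on :: "real set \<Rightarrow> (real \<Rightarrow> 'a::metric_space \<Rightarrow> 'a) \<Rightarrow> bool" where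
  "flow_axioms_on I f \<longleftrightarrow>
     (\<forall>p. f 0 p = p) \<and>
     continuous_on (I \<times> UNIV) (\<lambda>(t, p). f t p) \<and>
     (\<forall>t1\<in>I. \<forall>t2\<in>I. \<forall>p. f t1 (f t2 p) = f (t1 + t2) p)"

definition flow :: "real set \<Rightarrow> (real \<Rightarrow> 'a::metric_space \<Rightarrow> 'a) \<Rightarrow> bool" where
  "flow T f \<longleftrightarrow> flow_axioms_on T f"

definition semi_flow :: "real set \<Rightarrow> (real \<Rightarrow> 'a::metric_space \<Rightarrow> 'a) \<Rightarrow> bool" where
  "semi_flow T f \<longleftrightarrow> flow_axioms_on (nonneg T) f"

definition pos_semi_trajectory :: "real set \<Rightarrow> (real \<Rightarrow> 'a::metric_space \<Rightarrow> 'a) \<Rightarrow> 'a \<Rightarrow> 'a set" where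
  "pos_semi_trajectory T f p = {f t p | t. t \<in> nonneg T}"

definition Omega_plus :: "real set \<Rightarrow> (real \<Rightarrow> 'a::metric_space \<Rightarrow> 'a) \<Rightarrow> 'a \<Rightarrow> 'a set" where
  "Omega_plus T f p = closure (pos_semi_trajectory T f p)"

definition unpredictable :: "real set \<Rightarrow> (real \<Rightarrow> 'a::metric_space \<Rightarrow> 'a) \<Rightarrow> 'a \<Rightarrow> bool" where
  "unpredictable T f p \<longleftrightarrow>
     (\<exists>\<epsilon>0>0. \<exists>t \<tau> :: nat \<Rightarrow> real.
        (\<forall>n. t n \<in> nonneg T) \<and> (\<forall>n. \<tau> n \<in> nonneg T) \<and>
        filterlim t at_top sequentially \<and> filterlim \<tau> at_top sequentially \<and>
        (\<lambda>n. f (t n) p) \<longlonglongrightarrow> p \<and>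
        (\<forall>n. dist (f (t n + \<tau> n) p) (f (\<tau> n) p) \<ge> \<epsilon>0))"

definition sensitive_on :: "real set \<Rightarrow> (real \<Rightarrow> 'a::metric_space \<Rightarrow> 'a) \<Rightarrow> 'a set \<Rightarrow> bool" where
  "sensitive_on T f S \<longleftrightarrow>
     (\<exists>\<epsilon>0>0. \<forall>u\<in>S. \<forall>\<delta>>0. \<exists>v\<in>S. \<exists>\<tau>\<in>nonneg T.
        \<tau> > 0 \<and> dist v u < \<delta> \<and> dist (f \<tau> v) (f \<tau> u) \<ge> \<epsilon>0)"

end

theory Submission
  imports Defs
begin

text \<open>
  Approximate a point \<open>u\<close> of the closure by a trajectory point \<open>q = f s p\<close>. Continuity of \<open>f s\<close>
  carries the return \<open>f (t n) p \<longlonglongrightarrow> p\<close> over to \<open>f (t n) q \<longlonglongrightarrow> q\<close>, and after time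
  \<open>\<tau> n - s\<close> the points \<open>f (t n) q\<close> and \<open>q\<close> reach \<open>f (t n + \<tau> n) p\<close> and \<open>f (\<tau> n) p\<close>, which are
  \<open>\<epsilon>\<close>-separated. Both start near \<open>u\<close>, so by the triangle inequality one of them separates from
  \<open>u\<close> by \<open>\<epsilon> / 2\<close>.
\<close>

lemma flow_axioms_on_subset:
  assumes "flow_axioms_on I f" "J \<subseteq> I"
  shows "flow_axioms_on J f"
  using assms unfolding flow_axioms_on_def
  by (meson Sigma_mono continuous_on_subset order_refl subsetD)

text \<open>Joint continuity, restricted along \<open>Pair s\<close> to the slice at time
  \<open>s\<close>, makes the single map \<open>f s\<close> continuous on the whole space.\<close>

lemma flow_axioms_on_tendsto:
  assumes "flow_axioms_on I f" "s \<in> I" "(g \<longlongrightarrow> p) F"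
  shows "((\<lambda>n. f s (g n)) \<longlongrightarrow> f s p) F"
proof -
  have "continuous_on UNIV ((\<lambda>(t, p). f t p) \<circ> Pair s)"
    using assms(1,2) unfolding flow_axioms_on_def
    by (intro continuous_on_compose continuous_intros) (auto elim: continuous_on_subset)
  then have "isCont (f s) p"
    by (simp add: o_def continuous_on_eq_continuous_at)
  then show ?thesis
    using assms(3) by (rule isCont_tendsto_compose)
qed

theorem theorem3p1:
  fixes T :: "real set" and f :: "real \<Rightarrow> 'a::metric_space \<Rightarrow> 'a" and p :: 'a
  assumes "T = UNIV \<or> T = \<int>"
    and "semi_flow T f \<or> flow T f"
    and "unpredictable T f p"
  shows "sensitive_on T f (Omega_plus T f p)"
proof -
  have "nonneg T \<subseteq> T"
    by (auto simp: nonneg_def)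
  \<comment> \<open>A flow restricted to nonnegative times is a semi-flow, so one argument covers
    both cases.\<close>
  then have flow: "flow_axioms_on (nonneg T) f"
    using assms(2) flow_axioms_on_subset unfolding semi_flow_def flow_def by blast
  then have comp: "f a (f b x) = f (a + b) x" if "a \<in> nonneg T" "b \<in> nonneg T" for a b x
    using that by (simp add: flow_axioms_on_def)
  have add: "a + b \<in> nonneg T" if "a \<in> nonneg T" "b \<in> nonneg T" for a b
    using that assms(1) by (auto simp: nonneg_def)
  have diff: "a - b \<in> nonneg T" if "a \<in> nonneg T" "b \<in> nonneg T" "b \<le> a" for a b
    using that assms(1) by (auto simp: nonneg_def)
  have in_Omega: "f a p \<in> Omega_plus T f p" if "a \<in> nonneg T" for a
    unfolding Omega_plus_def pos_semi_trajectory_def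
    using that by (intro subsetD[OF closure_subset]) auto
  obtain \<epsilon> and t \<tau> :: "nat \<Rightarrow> real" where "\<epsilon> > 0"
    and t: "\<And>n. t n \<in> nonneg T" and \<tau>: "\<And>n. \<tau> n \<in> nonneg T"
    and \<tau>_top: "filterlim \<tau> at_top sequentially"
    and return: "(\<lambda>n. f (t n) p) \<longlonglongrightarrow> p"
    and sep: "\<And>n. dist (f (t n + \<tau> n) p) (f (\<tau> n) p) \<ge> \<epsilon>"
    using assms(3) unfolding unpredictable_def by metis
  have "\<exists>v\<in>Omega_plus T f p. \<exists>\<sigma>\<in>nonneg T. \<sigma> > 0 \<and> dist v u < \<delta> \<and> dist (f \<sigma> v) (f \<sigma> u) \<ge> \<epsilon> / 2"
    if u: "u \<in> Omega_plus T f p" and "\<delta> > 0" for u \<delta>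
  proof -
    obtain s where s: "s \<in> nonneg T" and near: "dist (f s p) u < \<delta>"
      using u \<open>\<delta> > 0\<close> unfolding Omega_plus_def closure_approachable pos_semi_trajectory_def
      by blast
    \<comment> \<open>Times commute, so \<open>f (t n) q\<close> may be written with
      \<open>f s\<close> outermost; continuity of that one fixed map then suffices.\<close>
    have "(\<lambda>n. f s (f (t n) p)) \<longlonglongrightarrow> f s p"
      using flow_axioms_on_tendsto[OF flow s return] .
    then have "(\<lambda>n. dist (f s (f (t n) p)) u) \<longlonglongrightarrow> dist (f s p) u"
      by (intro tendsto_intros)
    then have "\<forall>\<^sub>F n in sequentially. dist (f s (f (t n) p)) u < \<delta>"
      using near by (rule order_tendstoD)
    \<comment> \<open>Strict inequality makes the remaining time \<open>\<tau> n - s\<close>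
      positive, as sensitivity demands, and admissible for a semi-flow.\<close>
    moreover have "\<forall>\<^sub>F n in sequentially. s < \<tau> n"
      using \<tau>_top by (simp add: filterlim_at_top_dense)
    ultimately have "\<forall>\<^sub>F n in sequentially. dist (f s (f (t n) p)) u < \<delta> \<and> s < \<tau> n"
      by (rule eventually_conj)
    then obtain n where near': "dist (f s (f (t n) p)) u < \<delta>" and "s < \<tau> n"
      using eventually_happens'[OF sequentially_bot] by blast
    define \<sigma> where "\<sigma> = \<tau> n - s"
    have \<sigma>: "\<sigma> \<in> nonneg T" "\<sigma> > 0"
      using diff[OF \<tau> s] \<open>s < \<tau> n\<close> by (auto simp: \<sigma>_def)
    have "f \<sigma> (f s p) = f (\<tau> n) p"
      using comp[OF \<sigma>(1) s] by (simp add: \<sigma>_def)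
    \<comment> \<open>As \<open>\<sigma> + s = \<tau> n\<close>, applying \<open>f s\<close> and
      then \<open>f \<sigma>\<close> amounts to \<open>f (\<tau> n)\<close>, here at the point
      \<open>f (t n) p\<close>.\<close>
    moreover have "f \<sigma> (f s (f (t n) p)) = f (t n + \<tau> n) p"
      using comp[OF \<sigma>(1) s] comp[OF \<tau> t] by (simp add: \<sigma>_def add.commute)
    ultimately have "\<epsilon> \<le> dist (f \<sigma> (f s (f (t n) p))) (f \<sigma> (f s p))"
      using sep by simp
    also have "\<dots> \<le> dist (f \<sigma> (f s (f (t n) p))) (f \<sigma> u) + dist (f \<sigma> (f s p)) (f \<sigma> u)"
      by (rule dist_triangle2)
    finally have "dist (f \<sigma> (f s (f (t n) p))) (f \<sigma> u) \<ge> \<epsilon> / 2 \<or> dist (f \<sigma> (f s p)) (f \<sigma> u) \<ge> \<epsilon> / 2"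
      by linarith
    moreover have "f s (f (t n) p) \<in> Omega_plus T f p" "f s p \<in> Omega_plus T f p"
      using in_Omega s add[OF s t] comp[OF s t] by simp_all
    ultimately show ?thesis
      using \<sigma> near near' by blast
  qed
  \<comment> \<open>The bound \<open>\<epsilon> / 2\<close> depends on neither \<open>u\<close> nor
    \<open>\<delta>\<close>, so it serves as a sensitivity constant.\<close>
  then show ?thesis
    using \<open>\<epsilon> > 0\<close> unfolding sensitive_on_def by (intro exI[of _ "\<epsilon> / 2"]) simp
qed

end
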